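(* The logics $\mathbf{CPL}(\subseteq_0)$, $\mathbf{CPL}(\subseteq)$, $\mathbf{CPL}(\neq(\cdot))$ and $\mathbf{CPL}(\Upsilon)$ are all expressively complete in $\mathbb{P}^{\cup}$, the collection of all union closed team properties that contain the empty team. In particular, the five logics $\mathbf{CPL}(\dot\vee)$, $\mathbf{CPL}(\subseteq_0)$, $\mathbf{CPL}(\subseteq)$, $\mathbf{CPL}(\neq(\cdot))$ and $\mathbf{CPL}(\Upsilon)$ are pairwise expressively equivalent.
   Context: Fix a set $\mathsf{Prop}$ of propositional variables. Classical formulas (the logic $\mathbf{CPL}$): $\alpha::=p\mid\bot\mid\top\mid\neg\alpha\mid(\alpha\wedge\alpha)\mid(\alpha\vee\alpha)$ with $p\in\mathsf{Prop}$. For $\mathsf N\subseteq\mathsf{Prop}$, a valuation on $\mathsf N$ is a function $v:\mathsf N\cup\{\bot,\top\}\to\{0,1\}$ with $v(\bot)=0$, $v(\top)=1$; $2^{\mathsf N}$ is the set of all of them. An $\mathsf N$-team is a set $X\subseteq 2^{\mathsf N}$, with domain $\mathsf{dom}(X)=\mathsf N$ (the empty set is a team of any domain). For a sequence $\mathsf a=a_1\dots a_k$ write $v(\mathsf a)=\langle v(a_1),\dots,v(a_k)\rangle$. $\mathsf{Prop}(\phi)$ is the set of propositional variables occurring in $\phi$. Languages: each logic below is closed under $\wedge$ and $\vee$, contains $p,\bot,\top$ and $\neg\alpha$ for classical $\alpha$ only (negation is applied only to classical formulas), and in addition has: - $\mathbf{CPL}(\dot\vee)$: formulas $(\phi\mathbin{\dot\vee}\psi)$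 (relevant disjunction); - $\mathbf{CPL}(\subseteq)$: inclusion atoms $a_1\dots a_k\subseteq b_1\dots b_k$ with $a_i,b_i\in\mathsf{Prop}\cup\{\bot,\top\}$; - $\mathbf{CPL}(\subseteq_0)$: only primitive inclusion atoms $x_1\dots x_k\subseteq a_1\dots a_k$ with $x_i\in\{\bot,\top\}$, $a_i\in\mathsf{Prop}\cup\{\bot,\top\}$; - $\mathbf{CPL}(\Upsilon)$: anonymity atoms $p_1\dots p_k\Upsilon q_1\dots q_m$ with $p_i,q_j\in\mathsf{Prop}$ (sequences may be empty); - $\mathbf{CPL}(\neq(\cdot))$: only inconstancy atoms $\neq(p)$ with $p\in\mathsf{Prop}$, where $\neq(p)$ is the anonymity atom $\langle\rangle\Upsilon p$ with empty left sequence. Team semantics, for $X$ with $\mathsf{dom}(X)\supseteq\mathsf{Prop}(\phi)$: $X\models p$ iff $v(p)=1$ for all $v\in X$; $X\models\bot$ iff $X=\emptyset$; $X\models\top$ always; $X\models\neg\alpha$ iff $\{v\}\not\models\alpha$ for all $v\in X$; $X\models\phi\wedge\psi$ iff $X\models\phi$ and $X\models\psi$; $X\models\phi\vee\psi$ iff there are $Y,Z\subseteq X$ with $X=Y\cup Z$, $Y\models\phi$, $Z\models\psi$; $X\models\phi\mathbin{\dot\vee}\psi$ iff $X=\emptyset$ or there are nonempty $Y,Z\subseteq X$ with $X=Y\cup Z$, $Y\models\phi$, $Z\models\psi$; $X\models\mathsf a\subseteq\mathsf b$ iff for all $v\in X$ there is $u\in X$ with $v(\mathsf a)=u(\mathsf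 b)$; $X\models\mathsf p\Upsilon\mathsf q$ iff for all $v\in X$ there is $u\in X$ with $v(\mathsf p)=u(\mathsf p)$ and $v(\mathsf q)\neq u(\mathsf q)$. So $X\models\neq(p)$ iff $X=\emptyset$ or there are $v,u\in X$ with $v(p)\neq u(p)$. $\phi\equiv\psi$ means that every team $X$ with $\mathsf{dom}(X)\supseteq\mathsf{Prop}(\phi)\cup\mathsf{Prop}(\psi)$ satisfies $\phi$ iff it satisfies $\psi$. Two logics are expressively equivalent if every formula of either is $\equiv$ to some formula of the other. A team property over a domain $\mathsf N\subseteq\mathsf{Prop}$ is a set of $\mathsf N$-teams; it is union closed if it contains $X\cup Y$ whenever it contains $X$ and $Y$. For a formula $\phi$ with $\mathsf{Prop}(\phi)\subseteq\mathsf N$, $\llbracket\phi\rrbracket_{\mathsf N}=\{X\subseteq 2^{\mathsf N}: X\models\phi\}$. For a collection $\mathbb P$ of team properties, $\mathbb P_{\mathsf N}$ is the set of those members of $\mathbb P$ that are sets of $\mathsf N$-teams. A logic $\mathsf L$ is expressively complete in $\mathbb P$ if for every finite set $\mathsf N\subseteq\mathsf{Prop}$, $\mathbb P_{\mathsf N}=\{\llbracket\phi\rrbracket_{\mathsf N}:\phi\text{ is an }\mathsf L\text{-formula with }\mathsf{Prop}(\phi)=\mathsf N\}$. *)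

theory Defs
  imports Main
begin

text \<open>
  The type variable \<open>'p\<close> plays the role of the set of propositional variables.
  A valuation on \<open>N\<close> is a partial function with domain exactly \<open>N\<close>; its values at the
  constants \<open>\<bottom>\<close> and \<open>\<top>\<close> are supplied by \<open>val\<close> below.
\<close>

type_synonym 'p valuation = "'p \<rightharpoonup> bool"
type_synonym 'p team = "'p valuation set"
type_synonym 'p team_property = "'p team set"

definition valuations :: "'p set \<Rightarrow> 'p valuation set" where
  "valuations N = {v. dom v = N}"

definition teams :: "'p set \<Rightarrow> 'p team set" where
  "teams N = Pow (valuations N)"

datatype 'p atom = AVar 'p | ABot | ATop

primrec val :: "'p valuation \<Rightarrow> 'p atom \<Rightarrow> bool" where
  "val v (AVar p) = the (v p)"
| "val v ABot = False"
| "val v ATop = True"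

primrec atom_props :: "'p atom \<Rightarrow> 'p set" where
  "atom_props (AVar p) = {p}"
| "atom_props ABot = {}"
| "atom_props ATop = {}"

text \<open>
  A common syntax for all the logics. The side conditions (negation of classical formulas only,
  equal lengths of the two sides of an inclusion atom) are imposed by \<open>CPL\<close> below.
\<close>

datatype 'p form =
    Var 'p
  | Bot
  | Top
  | Neg "'p form"
  | And "'p form" "'p form"
  | Or "'p form" "'p form"
  | RelOr "'p form" "'p form"
  | Inclusion "'p atom list" "'p atom list"
  | Anonymity "'p list" "'p list"

abbreviation Inconstancy :: "'p \<Rightarrow> 'p form" where
  "Inconstancy p \<equiv> Anonymity [] [p]"

primrec props :: "'p form \<Rightarrow> 'p set" where
  "props (Var p) = {p}"
| "props Bot = {}"
| "props Top = {}"
| "props (Neg \<phi>) = props \<phi>"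
| "props (And \<phi> \<psi>) = props \<phi> \<union> props \<psi>"
| "props (Or \<phi> \<psi>) = props \<phi> \<union> props \<psi>"
| "props (RelOr \<phi> \<psi>) = props \<phi> \<union> props \<psi>"
| "props (Inclusion as bs) = \<Union> (atom_props ` (set as \<union> set bs))"
| "props (Anonymity ps qs) = set ps \<union> set qs"

inductive_set classical :: "'p form set" where
  "Var p \<in> classical"
| "Bot \<in> classical"
| "Top \<in> classical"
| "\<alpha> \<in> classical \<Longrightarrow> Neg \<alpha> \<in> classical"
| "\<alpha> \<in> classical \<Longrightarrow> \<beta> \<in> classical \<Longrightarrow> And \<alpha> \<beta> \<in> classical"
| "\<alpha> \<in> classical \<Longrightarrow> \<beta> \<in> classical \<Longrightarrow> Or \<alpha> \<beta> \<in> classical"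

datatype extension =
    Rel_Disj
  | Prim_Incl
  | Incl
  | Inconst
  | Anon

inductive_set CPL :: "extension \<Rightarrow> 'p form set" for E :: extension where
  Var: "Var p \<in> CPL E"
| Bot: "Bot \<in> CPL E"
| Top: "Top \<in> CPL E"
| Neg: "\<alpha> \<in> classical \<Longrightarrow> Neg \<alpha> \<in> CPL E"
| And: "\<phi> \<in> CPL E \<Longrightarrow> \<psi> \<in> CPL E \<Longrightarrow> And \<phi> \<psi> \<in> CPL E"
| Or: "\<phi> \<in> CPL E \<Longrightarrow> \<psi> \<in> CPL E \<Longrightarrow> Or \<phi> \<psi> \<in> CPL E"
| RelOr: "E = Rel_Disj \<Longrightarrow> \<phi> \<in> CPL E \<Longrightarrow> \<psi> \<in> CPL E \<Longrightarrow> RelOr \<phi> \<psi> \<in> CPL E"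
| Prim_Inclusion: "E = Prim_Incl \<Longrightarrow> length xs = length as \<Longrightarrow> set xs \<subseteq> {ABot, ATop} \<Longrightarrow>
    Inclusion xs as \<in> CPL E"
| Inclusion: "E = Incl \<Longrightarrow> length as = length bs \<Longrightarrow> Inclusion as bs \<in> CPL E"
| Inconstancy: "E = Inconst \<Longrightarrow> Inconstancy p \<in> CPL E"
| Anonymity: "E = Anon \<Longrightarrow> Anonymity ps qs \<in> CPL E"

text \<open>
  \<open>X \<Turnstile> \<phi>\<close> is only meaningful when \<open>X\<close> is a team on a domain including \<open>props \<phi>\<close>;
  all definitions below respect this.
\<close>

primrec sat :: "'p team \<Rightarrow> 'p form \<Rightarrow> bool" (infix "\<Turnstile>" 50) where
  "X \<Turnstile> Var p \<longleftrightarrow> (\<forall>v\<in>X. v p = Some True)"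
| "X \<Turnstile> Bot \<longleftrightarrow> X = {}"
| "X \<Turnstile> Top \<longleftrightarrow> True"
| "X \<Turnstile> Neg \<alpha> \<longleftrightarrow> (\<forall>v\<in>X. \<not> {v} \<Turnstile> \<alpha>)"
| "X \<Turnstile> And \<phi> \<psi> \<longleftrightarrow> X \<Turnstile> \<phi> \<and> X \<Turnstile> \<psi>"
| "X \<Turnstile> Or \<phi> \<psi> \<longleftrightarrow> (\<exists>Y Z. X = Y \<union> Z \<and> Y \<Turnstile> \<phi> \<and> Z \<Turnstile> \<psi>)"
| "X \<Turnstile> RelOr \<phi> \<psi> \<longleftrightarrow>
     X = {} \<or> (\<exists>Y Z. Y \<noteq> {} \<and> Z \<noteq> {} \<and> X = Y \<union> Z \<and> Y \<Turnstile> \<phi> \<and> Z \<Turnstile> \<psi>)"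
| "X \<Turnstile> Inclusion as bs \<longleftrightarrow> (\<forall>v\<in>X. \<exists>u\<in>X. map (val v) as = map (val u) bs)"
| "X \<Turnstile> Anonymity ps qs \<longleftrightarrow> (\<forall>v\<in>X. \<exists>u\<in>X. map v ps = map u ps \<and> map v qs \<noteq> map u qs)"

definition equivalent :: "'p form \<Rightarrow> 'p form \<Rightarrow> bool" where
  "equivalent \<phi> \<psi> \<longleftrightarrow>
     (\<forall>N X. props \<phi> \<union> props \<psi> \<subseteq> N \<and> X \<in> teams N \<longrightarrow> (X \<Turnstile> \<phi> \<longleftrightarrow> X \<Turnstile> \<psi>))"

definition expressively_equivalent :: "'p form set \<Rightarrow> 'p form set \<Rightarrow> bool" where
  "expressively_equivalent L L' \<longleftrightarrow>
     (\<forall>\<phi>\<in>L. \<exists>\<psi>\<in>L'. equivalent \<phi> \<psi>) \<and> (\<forall>\<psi>\<in>L'. \<exists>\<phi>\<in>L. equivalent \<psi> \<phi>)"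

definition denotation :: "'p set \<Rightarrow> 'p form \<Rightarrow> 'p team_property" where
  "denotation N \<phi> = {X \<in> teams N. X \<Turnstile> \<phi>}"

definition properties_over :: "'p set \<Rightarrow> 'p team_property set" where
  "properties_over N = Pow (teams N)"

definition union_closed :: "'p team_property \<Rightarrow> bool" where
  "union_closed P \<longleftrightarrow> (\<forall>X\<in>P. \<forall>Y\<in>P. X \<union> Y \<in> P)"

definition union_closed_properties :: "'p team_property set" where
  "union_closed_properties =
     {P. (\<exists>N. P \<in> properties_over N) \<and> union_closed P \<and> {} \<in> P}"

definition expressively_complete :: "'p form set \<Rightarrow> 'p team_property set \<Rightarrow> bool" where
  "expressively_complete L \<P> \<longleftrightarrow>
     (\<forall>N. finite N \<longrightarrow>
        \<P> \<inter> properties_over N = {denotation N \<phi> | \<phi>. \<phi> \<in> L \<and> props \<phi> = N})"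

end

theory Submission
  imports Defs
begin

text \<open>
  All five logics can express inconstancy of a variable \<open>p\<close>: directly, or as
  \<open>\<bottom> \<subseteq> p \<and> \<top> \<subseteq> p\<close>, or as the relevant disjunction of \<open>p\<close> and \<open>\<not>p\<close>
  (lemma \<open>inconstancy_definable\<close>). This single ability already yields every union closed
  property that contains the empty team, so one argument serves all five logics.

  The key point is that inconstancy isolates a single team \<open>X\<close>, that is, defines the property
  \<open>{\<emptyset>, X}\<close> (lemma \<open>single_team_definable\<close>). If \<open>X\<close> has two distinct valuations, they differ at
  some \<open>p\<close>, and \<open>p\<close> splits \<open>X\<close> into two smaller nonempty teams \<open>A\<close> and \<open>B\<close>. The disjunction of
  formulas isolating \<open>A\<close> and \<open>B\<close> defines \<open>{\<emptyset>, A, B, X}\<close>, and of these teams only \<open>\<emptyset>\<close> and \<open>X\<close>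
  pass the additional demand that \<open>p\<close> be inconstant. When \<open>X\<close> is a singleton, a conjunction of
  literals suffices.

  Since a disjunction defines the property of being a union of one team from each disjunct,
  the disjunction over all \<open>X \<in> P\<close> of formulas isolating \<open>X\<close> defines the set of all unions of
  members of \<open>P\<close>, which is \<open>P\<close> itself when \<open>P\<close> is union closed and contains \<open>\<emptyset>\<close>. Conversely,
  every formula is union closed and true in the empty team.

  For expressive equivalence, the property that a formula defines over its own variables is
  defined by a formula of the other logic with the same variables. Satisfaction depends only
  on the values of the variables that occur (lemma \<open>sat_image\<close>), so the two formulas then
  agree over all larger domains too.
\<close>

section \<open>Empty team property, union closure and locality\<close>

lemma sat_empty: "{} \<Turnstile> \<phi>"
  by (induction \<phi>) auto

lemma sat_OrI: "X = Y \<union> Z \<Longrightarrow> Y \<Turnstile> \<phi> \<Longrightarrow> Z \<Turnstile> \<psi> \<Longrightarrow> X \<Turnstile> Or \<phi> \<psi>"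
  unfolding sat.simps by blast

lemma sat_RelOrI:
  "X = Y \<union> Z \<Longrightarrow> Y \<Turnstile> \<phi> \<Longrightarrow> Z \<Turnstile> \<psi> \<Longrightarrow> Y \<noteq> {} \<Longrightarrow> Z \<noteq> {} \<Longrightarrow> X \<Turnstile> RelOr \<phi> \<psi>"
  unfolding sat.simps by blast

lemma sat_union: "X \<Turnstile> \<phi> \<Longrightarrow> Y \<Turnstile> \<phi> \<Longrightarrow> X \<union> Y \<Turnstile> \<phi>"
proof (induction \<phi> arbitrary: X Y)
  case (Or \<phi> \<psi>)
  then obtain A B C D where "X = A \<union> B" "A \<Turnstile> \<phi>" "B \<Turnstile> \<psi>" "Y = C \<union> D" "C \<Turnstile> \<phi>" "D \<Turnstile> \<psi>"
    by auto
  then have "X \<union> Y = (A \<union> C) \<union> (B \<union> D)" "A \<union> C \<Turnstile> \<phi>" "B \<union> D \<Turnstile> \<psi>"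
    using Or.IH by auto
  then show ?case by (rule sat_OrI)
next
  case (RelOr \<phi> \<psi>)
  show ?case
  proof (cases "X = {} \<or> Y = {}")
    case True
    then show ?thesis using RelOr.prems by (elim disjE) (simp_all del: sat.simps)
  next
    case False
    from False RelOr.prems(1) obtain A B
      where X: "X = A \<union> B" "A \<Turnstile> \<phi>" "B \<Turnstile> \<psi>" "A \<noteq> {}" "B \<noteq> {}"
      unfolding sat.simps by blast
    from False RelOr.prems(2) obtain C D
      where Y: "Y = C \<union> D" "C \<Turnstile> \<phi>" "D \<Turnstile> \<psi>" "C \<noteq> {}" "D \<noteq> {}"
      unfolding sat.simps by blast
    have "X \<union> Y = (A \<union> C) \<union> (B \<union> D)" using X(1) Y(1) by (simp add: Un_ac)
    moreover have "A \<union> C \<Turnstile> \<phi>" "B \<union> D \<Turnstile> \<psi>" "A \<union> C \<noteq> {}" "B \<union> D \<noteq> {}"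
      using X Y RelOr.IH by simp_all
    ultimately show ?thesis by (rule sat_RelOrI)
  qed
next
  case (Inclusion as bs)
  then show ?case unfolding sat.simps by blast
next
  case (Anonymity ps qs)
  then show ?case unfolding sat.simps by blast
qed auto

lemma val_cong: "(\<And>p. p \<in> atom_props a \<Longrightarrow> v p = w p) \<Longrightarrow> val v a = val w a"
  by (cases a) auto

lemma image_eq_UnE:
  assumes "f ` X = Y \<union> Z"
  obtains A B where "X = A \<union> B" "f ` A = Y" "f ` B = Z"
proof
  show "X = {x \<in> X. f x \<in> Y} \<union> {x \<in> X. f x \<in> Z}"
    using assms by (auto simp: set_eq_iff)
  show "f ` {x \<in> X. f x \<in> Y} = Y" "f ` {x \<in> X. f x \<in> Z} = Z"
    using equalityD2[OF assms] by auto
qed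

text \<open>
  The map \<open>f\<close> need not be injective. This is harmless because a splitting of \<open>f ` X\<close> pulls
  back along \<open>f\<close> to a splitting of \<open>X\<close>: the two parts of a disjunction may overlap.
\<close>

lemma sat_image:
  assumes "\<And>v p. v \<in> X \<Longrightarrow> p \<in> props \<phi> \<Longrightarrow> f v p = v p"
  shows "f ` X \<Turnstile> \<phi> \<longleftrightarrow> X \<Turnstile> \<phi>"
  using assms
proof (induction \<phi> arbitrary: X)
  case (Neg \<alpha>)
  have "{f v} \<Turnstile> \<alpha> \<longleftrightarrow> {v} \<Turnstile> \<alpha>" if "v \<in> X" for v
    using Neg.IH[of "{v}"] Neg.prems that by simp
  then show ?case by simp
next
  case (Or \<phi> \<psi>)
  have sub: "f ` Y \<Turnstile> \<phi> \<longleftrightarrow> Y \<Turnstile> \<phi>" "f ` Y \<Turnstile> \<psi> \<longleftrightarrow> Y \<Turnstile> \<psi>" if "Y \<subseteq> X" for Y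
    using Or.IH(1)[of Y] Or.IH(2)[of Y] Or.prems that by auto
  show ?case
  proof
    assume "f ` X \<Turnstile> Or \<phi> \<psi>"
    then obtain Y Z where YZ: "f ` X = Y \<union> Z" "Y \<Turnstile> \<phi>" "Z \<Turnstile> \<psi>"
      unfolding sat.simps by blast
    obtain A B where X: "X = A \<union> B" and "f ` A = Y" "f ` B = Z"
      using image_eq_UnE[OF YZ(1)] .
    then have "A \<Turnstile> \<phi>" "B \<Turnstile> \<psi>" using sub[of A] sub[of B] YZ(2,3) by auto
    with X show "X \<Turnstile> Or \<phi> \<psi>" by (rule sat_OrI)
  next
    assume "X \<Turnstile> Or \<phi> \<psi>"
    then obtain Y Z where "X = Y \<union> Z" "Y \<Turnstile> \<phi>" "Z \<Turnstile> \<psi>" by auto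
    then have "f ` X = f ` Y \<union> f ` Z" "f ` Y \<Turnstile> \<phi>" "f ` Z \<Turnstile> \<psi>" using sub by auto
    then show "f ` X \<Turnstile> Or \<phi> \<psi>" by (rule sat_OrI)
  qed
next
  case (RelOr \<phi> \<psi>)
  have sub: "f ` Y \<Turnstile> \<phi> \<longleftrightarrow> Y \<Turnstile> \<phi>" "f ` Y \<Turnstile> \<psi> \<longleftrightarrow> Y \<Turnstile> \<psi>" if "Y \<subseteq> X" for Y
    using RelOr.IH(1)[of Y] RelOr.IH(2)[of Y] RelOr.prems that by auto
  show ?case
  proof (cases "X = {}")
    case False
    show ?thesis
    proof
      assume "f ` X \<Turnstile> RelOr \<phi> \<psi>"
      then obtain Y Z where YZ: "f ` X = Y \<union> Z" "Y \<Turnstile> \<phi>" "Z \<Turnstile> \<psi>" "Y \<noteq> {}" "Z \<noteq> {}"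
        using False unfolding sat.simps by blast
      obtain A B where X: "X = A \<union> B" and "f ` A = Y" "f ` B = Z"
        using image_eq_UnE[OF YZ(1)] .
      then have "A \<Turnstile> \<phi>" "B \<Turnstile> \<psi>" "A \<noteq> {}" "B \<noteq> {}"
        using sub[of A] sub[of B] YZ(2-5) by auto
      with X show "X \<Turnstile> RelOr \<phi> \<psi>" by (rule sat_RelOrI)
    next
      assume "X \<Turnstile> RelOr \<phi> \<psi>"
      then obtain Y Z where "X = Y \<union> Z" "Y \<Turnstile> \<phi>" "Z \<Turnstile> \<psi>" "Y \<noteq> {}" "Z \<noteq> {}"
        using False unfolding sat.simps by blast
      then have "f ` X = f ` Y \<union> f ` Z" "f ` Y \<Turnstile> \<phi>" "f ` Z \<Turnstile> \<psi>" "f ` Y \<noteq> {}" "f ` Z \<noteq> {}"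
        using sub by auto
      then show "f ` X \<Turnstile> RelOr \<phi> \<psi>" by (rule sat_RelOrI)
    qed
  qed simp
next
  case (Inclusion as bs)
  have eq: "map (val (f v)) as = map (val v) as" "map (val (f v)) bs = map (val v) bs"
    if "v \<in> X" for v
    using Inclusion.prems that by (auto intro!: val_cong)
  show ?case by (simp only: sat.simps ball_simps bex_simps eq cong: ball_cong bex_cong)
next
  case (Anonymity ps qs)
  have eq: "map (f v) ps = map v ps" "map (f v) qs = map v qs" if "v \<in> X" for v
    using Anonymity.prems that by auto
  show ?case by (simp only: sat.simps ball_simps bex_simps eq cong: ball_cong bex_cong)
qed auto

lemma finite_props: "finite (props \<phi>)"
proof (induction \<phi>)
  case (Inclusion as bs)
  have "finite (atom_props a)" for a :: "'a atom" by (cases a) auto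
  then show ?case by simp
qed auto

lemma denotation_union_closed:
  "denotation N \<phi> \<in> union_closed_properties \<inter> properties_over N"
proof -
  have "denotation N \<phi> \<in> properties_over N"
    unfolding denotation_def properties_over_def by auto
  moreover have "union_closed (denotation N \<phi>)"
    unfolding union_closed_def denotation_def teams_def by (auto intro: sat_union)
  ultimately show ?thesis
    unfolding union_closed_properties_def
    by (auto simp: denotation_def teams_def sat_empty)
qed

lemma same_denotation_imp_equivalent:
  assumes "props \<phi> = N" "props \<psi> = N" "denotation N \<phi> = denotation N \<psi>"
  shows "equivalent \<phi> \<psi>"
  unfolding equivalent_def
proof (intro allI impI)
  fix M X
  assume M: "props \<phi> \<union> props \<psi> \<subseteq> M \<and> X \<in> teams M"
  let ?Y = "(\<lambda>v. v |` N) ` X"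
  have "dom (v |` N) = N" if "v \<in> X" for v
  proof -
    have "v \<in> valuations M" using M that unfolding teams_def by blast
    moreover have "N \<subseteq> M" using M assms(1) by simp
    ultimately show ?thesis by (simp add: valuations_def Int_absorb1)
  qed
  then have "?Y \<in> teams N" by (simp add: teams_def valuations_def image_subset_iff)
  then have "?Y \<Turnstile> \<phi> \<longleftrightarrow> ?Y \<Turnstile> \<psi>"
    using assms(3) by (auto simp: denotation_def set_eq_iff)
  moreover have "?Y \<Turnstile> \<phi> \<longleftrightarrow> X \<Turnstile> \<phi>" "?Y \<Turnstile> \<psi> \<longleftrightarrow> X \<Turnstile> \<psi>"
    by (rule sat_image; simp add: assms(1,2))+
  ultimately show "X \<Turnstile> \<phi> \<longleftrightarrow> X \<Turnstile> \<psi>" by simp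
qed

section \<open>Definable team properties\<close>

text \<open>
  Only an inclusion \<open>props \<phi> \<subseteq> N\<close> is required here, so that properties definable over \<open>N\<close> can
  be combined freely. Lemma \<open>definable_exact_props\<close> upgrades it to an equality.
\<close>

definition definable :: "extension \<Rightarrow> 'p set \<Rightarrow> 'p team_property \<Rightarrow> bool" where
  "definable E N P \<longleftrightarrow> (\<exists>\<phi>\<in>CPL E. props \<phi> \<subseteq> N \<and> denotation N \<phi> = P)"

lemma definableI:
  assumes "\<phi> \<in> CPL E" "props \<phi> \<subseteq> N" "\<And>X. X \<in> P \<longleftrightarrow> X \<in> teams N \<and> X \<Turnstile> \<phi>"
  shows "definable E N P"
  using assms unfolding definable_def denotation_def by blast

lemma definable_empty_team: "definable E N {{}}"
  by (rule definableI[OF CPL.Bot]) (auto simp: teams_def)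

lemma definable_teams: "definable E N (teams N)"
  by (rule definableI[OF CPL.Top]) auto

lemma definable_Int:
  assumes "definable E N P" "definable E N Q"
  shows "definable E N (P \<inter> Q)"
proof -
  obtain \<phi> \<psi> where \<phi>: "\<phi> \<in> CPL E" "props \<phi> \<subseteq> N" "denotation N \<phi> = P"
    and \<psi>: "\<psi> \<in> CPL E" "props \<psi> \<subseteq> N" "denotation N \<psi> = Q"
    using assms unfolding definable_def by blast
  have "denotation N (And \<phi> \<psi>) = denotation N \<phi> \<inter> denotation N \<psi>"
    by (auto simp: denotation_def)
  then show ?thesis
    unfolding definable_def using \<phi> \<psi> by (intro bexI[of _ "And \<phi> \<psi>"]) (simp_all add: CPL.And)
qed

lemma definable_join:
  assumes "definable E N P" "definable E N Q"
  shows "definable E N {Y \<union> Z | Y Z. Y \<in> P \<and> Z \<in> Q}"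
proof -
  obtain \<phi> \<psi> where \<phi>: "\<phi> \<in> CPL E" "props \<phi> \<subseteq> N" "denotation N \<phi> = P"
    and \<psi>: "\<psi> \<in> CPL E" "props \<psi> \<subseteq> N" "denotation N \<psi> = Q"
    using assms unfolding definable_def by blast
  have "denotation N (Or \<phi> \<psi>) =
      {Y \<union> Z | Y Z. Y \<in> denotation N \<phi> \<and> Z \<in> denotation N \<psi>}"
    unfolding denotation_def teams_def sat.simps by blast
  then show ?thesis
    unfolding definable_def using \<phi> \<psi> by (intro bexI[of _ "Or \<phi> \<psi>"]) (simp_all add: CPL.Or)
qed

lemma definable_exact_props:
  assumes "finite N" "definable E N P"
  shows "\<exists>\<phi>\<in>CPL E. props \<phi> = N \<and> denotation N \<phi> = P"
proof -
  obtain \<phi> where \<phi>: "\<phi> \<in> CPL E" "props \<phi> \<subseteq> N" "denotation N \<phi> = P"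
    using assms(2) unfolding definable_def by blast
  \<comment> \<open>The missing variables are added by conjoining the tautologies \<open>\<not>(p \<and> \<bottom>)\<close>.\<close>
  have "\<exists>\<psi>\<in>CPL E. props \<psi> = M \<and> (\<forall>X. X \<Turnstile> \<psi>)" if "finite M" for M :: "'a set"
    using that
  proof induction
    case empty
    then show ?case by (intro bexI[OF _ CPL.Top]) auto
  next
    case (insert p M)
    then obtain \<psi> where "\<psi> \<in> CPL E" "props \<psi> = M" "\<forall>X. X \<Turnstile> \<psi>" by blast
    then show ?case
      by (intro bexI[of _ "And (Neg (And (Var p) Bot)) \<psi>"])
        (auto intro!: CPL.And CPL.Neg classical.intros)
  qed
  from this[OF assms(1)] obtain \<psi> where "\<psi> \<in> CPL E" "props \<psi> = N" "\<forall>X. X \<Turnstile> \<psi>" by blast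
  with \<phi> show ?thesis
    by (intro bexI[of _ "And \<phi> \<psi>"]) (auto simp: denotation_def intro: CPL.And)
qed

section \<open>Isolating a single team\<close>

lemma inconstancy_definable:
  assumes "p \<in> N"
  shows "definable E N {X \<in> teams N. X = {} \<or> (\<exists>u\<in>X. \<exists>v\<in>X. u p \<noteq> v p)}"
proof -
  have two_values: "v p = Some True \<or> v p = Some False" if "v \<in> X" "X \<in> teams N" for v X
  proof -
    have "p \<in> dom v" using that assms unfolding teams_def valuations_def by blast
    then show ?thesis by auto
  qed
  have inconstant_iff: "(X = {} \<or> (\<exists>u\<in>X. \<exists>v\<in>X. u p \<noteq> v p)) \<longleftrightarrow>
      X = {} \<or> (\<exists>u\<in>X. u p = Some True) \<and> (\<exists>v\<in>X. v p = Some False)"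
    if "X \<in> teams N" for X
    using two_values[OF _ that] by (metis option.inject)
  have direct: "X \<Turnstile> Inconstancy p \<longleftrightarrow> X = {} \<or> (\<exists>u\<in>X. \<exists>v\<in>X. u p \<noteq> v p)" for X
    by (auto; metis)
  let ?incl = "And (Inclusion [ABot] [AVar p]) (Inclusion [ATop] [AVar p])"
  have incl: "X \<Turnstile> ?incl \<longleftrightarrow> X = {} \<or> (\<exists>u\<in>X. \<exists>v\<in>X. u p \<noteq> v p)" if X: "X \<in> teams N" for X
  proof -
    have "the (v p) \<longleftrightarrow> v p = Some True" "\<not> the (v p) \<longleftrightarrow> v p = Some False" if "v \<in> X" for v
      using two_values[OF that X] by auto
    then show ?thesis unfolding inconstant_iff[OF X] by auto
  qed
  let ?rel = "RelOr (Var p) (Neg (Var p))"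
  have rel: "X \<Turnstile> ?rel \<longleftrightarrow> X = {} \<or> (\<exists>u\<in>X. \<exists>v\<in>X. u p \<noteq> v p)" if X: "X \<in> teams N" for X
  proof
    assume "X \<Turnstile> ?rel"
    then consider "X = {}" | Y Z where "X = Y \<union> Z" "Y \<noteq> {}" "Z \<noteq> {}"
        "\<forall>v\<in>Y. v p = Some True" "\<forall>v\<in>Z. v p \<noteq> Some True"
      by auto
    then show "X = {} \<or> (\<exists>u\<in>X. \<exists>v\<in>X. u p \<noteq> v p)"
      by cases (simp, metis UnCI ex_in_conv)
  next
    assume inconst: "X = {} \<or> (\<exists>u\<in>X. \<exists>v\<in>X. u p \<noteq> v p)"
    let ?Y = "{v \<in> X. v p = Some True}" and ?Z = "{v \<in> X. v p = Some False}"
    show "X \<Turnstile> ?rel"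
    proof (cases "X = {}")
      case True
      then show ?thesis by (simp only: sat_empty)
    next
      case False
      then have "?Y \<noteq> {}" "?Z \<noteq> {}" using inconst unfolding inconstant_iff[OF X] by blast+
      moreover have "X = ?Y \<union> ?Z" using two_values[OF _ X] by blast
      moreover have "?Y \<Turnstile> Var p" "?Z \<Turnstile> Neg (Var p)" by auto
      ultimately show ?thesis by (intro sat_RelOrI)
    qed
  qed
  show ?thesis
  proof (cases E)
    case Rel_Disj
    then show ?thesis using rel assms
      by (intro definableI[of ?rel]) (auto simp del: sat.simps intro!: CPL.RelOr CPL.Var CPL.Neg classical.intros)
  next
    case Prim_Incl
    then show ?thesis using incl assms
      by (intro definableI[of ?incl])
        (auto simp del: sat.simps intro!: CPL.And CPL.Prim_Inclusion)
  next
    case Incl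
    then show ?thesis using incl assms
      by (intro definableI[of ?incl]) (auto simp del: sat.simps intro!: CPL.And CPL.Inclusion)
  next
    case Inconst
    then show ?thesis using direct assms
      by (intro definableI[of "Inconstancy p"])
        (auto simp del: sat.simps intro: CPL.Inconstancy)
  next
    case Anon
    then show ?thesis using direct assms
      by (intro definableI[of "Inconstancy p"])
        (auto simp del: sat.simps intro: CPL.Anonymity)
  qed
qed

lemma literal_definable:
  assumes "p \<in> N" "v \<in> valuations N"
  shows "definable E N {X \<in> teams N. \<forall>u\<in>X. u p = v p}"
proof (cases "v p = Some True")
  case True
  then show ?thesis using assms by (intro definableI[OF CPL.Var[of p]]) auto
next
  case False
  have False_iff: "u p = Some False \<longleftrightarrow> u p \<noteq> Some True" if "u \<in> valuations N" for u
  proof -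
    have "p \<in> dom u" using that assms(1) unfolding valuations_def by blast
    then show ?thesis by auto
  qed
  then have "v p = Some False" using False assms(2) by blast
  then show ?thesis using assms(1) False_iff
    by (intro definableI[of "Neg (Var p)"])
      (auto simp: teams_def subset_iff intro!: CPL.Neg classical.intros)
qed

lemma singleton_definable:
  assumes "finite N" "v \<in> valuations N"
  shows "definable E N {{}, {v}}"
proof -
  have "definable E N {X \<in> teams N. \<forall>u\<in>X. \<forall>p\<in>M. u p = v p}" if "M \<subseteq> N" for M
    using finite_subset[OF that assms(1)] that
  proof induction
    case empty
    then show ?case using definable_teams by simp
  next
    case (insert p M)
    have "{X \<in> teams N. \<forall>u\<in>X. \<forall>q\<in>insert p M. u q = v q} =
        {X \<in> teams N. \<forall>u\<in>X. u p = v p} \<inter> {X \<in> teams N. \<forall>u\<in>X. \<forall>q\<in>M. u q = v q}"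
      by auto
    then show ?case
      using insert assms(2) by (simp add: definable_Int literal_definable)
  qed
  moreover have "{X \<in> teams N. \<forall>u\<in>X. \<forall>p\<in>N. u p = v p} = {{}, {v}}"
  proof -
    have "u = v" if "u \<in> valuations N" "\<forall>p\<in>N. u p = v p" for u
    proof
      fix p
      show "u p = v p"
        using that assms(2) unfolding valuations_def by (cases "p \<in> N") (auto simp: dom_def)
    qed
    then have "X \<subseteq> {v}" if "X \<in> teams N" "\<forall>u\<in>X. \<forall>p\<in>N. u p = v p" for X
      using that unfolding teams_def by blast
    moreover have "{} \<in> teams N" "{v} \<in> teams N" using assms(2) by (auto simp: teams_def)
    ultimately show ?thesis by (auto dest!: subset_singletonD)
  qed
  ultimately show ?thesis by force
qed

lemma finite_valuations:
  assumes "finite N"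
  shows "finite (valuations N)"
  unfolding valuations_def
  using finite_set_of_finite_maps[OF assms, of "UNIV :: bool set"] by simp

text \<open>
  A variable on which \<open>X\<close> is inconstant splits \<open>X\<close> into two smaller teams, and inconstancy of
  that variable forces a team built from them to contain both, or neither.
\<close>

lemma single_team_definable:
  assumes "finite N" "X \<in> teams N"
  shows "definable E N {{}, X}"
proof -
  have "finite X"
    using assms finite_valuations unfolding teams_def by (blast intro: finite_subset)
  then show ?thesis
    using assms(2)
  proof (induction X rule: finite_psubset_induct)
    case (psubset X)
    consider "X = {}" | v where "X = {v}" | v w where "v \<in> X" "w \<in> X" "v \<noteq> w"
      by blast
    then show ?case
    proof cases
      case 1
      then show ?thesis using definable_empty_team by simp
    next
      case 2
      then show ?thesis
        using psubset.prems singleton_definable[OF assms(1)] by (simp add: teams_def)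
    next
      case 3
      then obtain p where p: "v p \<noteq> w p" by blast
      have "dom v = N" "dom w = N"
        using 3 psubset.prems unfolding teams_def valuations_def by auto
      then have "p \<in> N" using p by (metis domIff)
      let ?A = "{u \<in> X. u p = v p}" and ?B = "{u \<in> X. u p \<noteq> v p}"
      let ?I = "{Y \<in> teams N. Y = {} \<or> (\<exists>u\<in>Y. \<exists>v\<in>Y. u p \<noteq> v p)}"
      have AB: "?A \<subset> X" "?B \<subset> X" "?A \<union> ?B = X" using 3 p by force+
      have teams: "?A \<in> teams N" "?B \<in> teams N" "{} \<in> teams N"
        using psubset.prems by (auto simp: teams_def)
      have not_inconstant: "Y \<notin> ?I" if "z \<in> Y" "\<And>u. u \<in> Y \<Longrightarrow> u p = z p" for Y z
        using that by (auto; metis)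
      have "definable E N {{}, ?A}" "definable E N {{}, ?B}"
        using psubset.IH AB(1,2) teams by blast+
      then have "definable E N ({Y \<union> Z | Y Z. Y \<in> {{}, ?A} \<and> Z \<in> {{}, ?B}} \<inter> ?I)"
        using inconstancy_definable[OF \<open>p \<in> N\<close>] by (intro definable_Int definable_join)
      moreover have "{Y \<union> Z | Y Z. Y \<in> {{}, ?A} \<and> Z \<in> {{}, ?B}} = {{}, ?A, ?B, X}"
        using AB(3) by (auto; blast)
      moreover have "?A \<notin> ?I" using 3(1) by (intro not_inconstant[of v]) simp_all
      moreover have "?B \<notin> ?I"
      proof -
        \<comment> \<open>Since \<open>p\<close> takes only two values, it is constant on \<open>B\<close> as well.\<close>
        have "u p = w p" if "u \<in> ?B" for u
        proof -
          have "dom u = N" using that psubset.prems unfolding teams_def valuations_def by auto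
          then have "u p \<noteq> None" "v p \<noteq> None" "w p \<noteq> None"
            using \<open>p \<in> N\<close> \<open>dom v = N\<close> \<open>dom w = N\<close> by blast+
          then show ?thesis using that p by auto
        qed
        moreover have "w \<in> ?B" using 3(2) p by simp
        ultimately show ?thesis by (intro not_inconstant[of w])
      qed
      moreover have "{} \<in> ?I" "X \<in> ?I" using 3 p psubset.prems teams(3) by blast+
      ultimately show ?thesis by (simp only: Int_insert_left if_True if_False Int_empty_left)
    qed
  qed
qed

section \<open>Expressive completeness\<close>

lemma union_closed_Union:
  assumes "union_closed P" "{} \<in> P" "finite G" "G \<subseteq> P"
  shows "\<Union>G \<in> P"
  using assms(3,4) by induction (use assms(1,2) in \<open>auto simp: union_closed_def\<close>)

lemma unions_definable:
  assumes "finite N" "finite F" "F \<subseteq> teams N"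
  shows "definable E N {\<Union>G | G. G \<subseteq> F}"
  using assms(2,3)
proof induction
  case empty
  then show ?case using definable_empty_team by simp
next
  case (insert X F)
  have "{\<Union>G | G. G \<subseteq> insert X F} = {Y \<union> Z | Y Z. Y \<in> {{}, X} \<and> Z \<in> {\<Union>G | G. G \<subseteq> F}}"
    (is "?L = ?R")
  proof (intro equalityI subsetI)
    fix T assume "T \<in> ?L"
    then obtain G where G: "G \<subseteq> insert X F" "T = \<Union>G" by blast
    then have "T = (if X \<in> G then X else {}) \<union> \<Union>(G - {X})" "G - {X} \<subseteq> F" by auto
    then show "T \<in> ?R" by (smt (verit) insertCI mem_Collect_eq)
  next
    fix T assume "T \<in> ?R"
    then obtain Y G where G: "Y \<in> {{}, X}" "G \<subseteq> F" "T = Y \<union> \<Union>G" by blast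
    show "T \<in> ?L"
    proof (cases "Y = X")
      case True
      then have "T = \<Union>(insert X G)" "insert X G \<subseteq> insert X F" using G by auto
      then show ?thesis by blast
    next
      case False
      then have "T = \<Union>G" "G \<subseteq> insert X F" using G by auto
      then show ?thesis by blast
    qed
  qed
  moreover have "definable E N {{}, X}" "definable E N {\<Union>G | G. G \<subseteq> F}"
    using insert single_team_definable[OF assms(1)] by simp_all
  ultimately show ?case by (simp only: definable_join)
qed

text \<open>
  Over a finite domain there are only finitely many teams, so a union closed property containing
  \<open>\<emptyset>\<close> consists exactly of the unions of its subfamilies.
\<close>

lemma union_closed_definable:
  assumes "finite N" "P \<subseteq> teams N" "union_closed P" "{} \<in> P"
  shows "definable E N P"
proof -
  have "finite P"
    using finite_valuations[OF assms(1)] assms(2) unfolding teams_def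
    by (blast intro: finite_subset)
  have "{\<Union>G | G. G \<subseteq> P} = P"
  proof
    show "{\<Union>G | G. G \<subseteq> P} \<subseteq> P"
      using union_closed_Union[OF assms(3,4)] \<open>finite P\<close> finite_subset by blast
    show "P \<subseteq> {\<Union>G | G. G \<subseteq> P}"
    proof
      fix X assume "X \<in> P"
      then have "X = \<Union>{X}" "{X} \<subseteq> P" by auto
      then show "X \<in> {\<Union>G | G. G \<subseteq> P}" by blast
    qed
  qed
  then show ?thesis using unions_definable[OF assms(1) \<open>finite P\<close> assms(2), of E] by simp
qed

lemma CPL_expressively_complete: "expressively_complete (CPL E) union_closed_properties"
  unfolding expressively_complete_def
proof (intro allI impI equalityI subsetI)
  fix N :: "'a set" and P
  assume N: "finite N" and "P \<in> union_closed_properties \<inter> properties_over N"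
  then have "definable E N P"
    by (intro union_closed_definable)
      (auto simp: union_closed_properties_def properties_over_def)
  then show "P \<in> {denotation N \<phi> | \<phi>. \<phi> \<in> CPL E \<and> props \<phi> = N}"
    using definable_exact_props[OF N] by blast
next
  fix N :: "'a set" and P
  assume "P \<in> {denotation N \<phi> | \<phi>. \<phi> \<in> CPL E \<and> props \<phi> = N}"
  then show "P \<in> union_closed_properties \<inter> properties_over N"
    using denotation_union_closed by blast
qed

lemma expressively_complete_imp_translation:
  assumes "expressively_complete L union_closed_properties"
  shows "\<exists>\<psi>\<in>L. equivalent \<phi> \<psi>"
proof -
  obtain \<psi> where
    "\<psi> \<in> L" "props \<psi> = props \<phi>" "denotation (props \<phi>) \<phi> = denotation (props \<phi>) \<psi>"
    using denotation_union_closed[of "props \<phi>" \<phi>] assms finite_props[of \<phi>]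
    unfolding expressively_complete_def by blast
  then show ?thesis using same_denotation_imp_equivalent by blast
qed

theorem theorem3p7:
  shows "(\<forall>E \<in> {Prim_Incl, Incl, Inconst, Anon}.
            expressively_complete (CPL E :: 'p form set) union_closed_properties) \<and>
         (\<forall>E \<in> {Rel_Disj, Prim_Incl, Incl, Inconst, Anon}.
          \<forall>E' \<in> {Rel_Disj, Prim_Incl, Incl, Inconst, Anon}.
            expressively_equivalent (CPL E :: 'p form set) (CPL E'))"
  unfolding expressively_equivalent_def
  using CPL_expressively_complete expressively_complete_imp_translation by blast

end
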